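(* Let $\mathbf A\in\mathbb R^{m\times n}$ be a nonzero matrix with rank $r$ and nonzero singular values $\sigma_1(\mathbf A)\ge\cdots\ge\sigma_r(\mathbf A)>0$, and let $\mathbf b\in\mathbb R^m$ be such that the linear system $\mathbf A\mathbf x=\mathbf b$ is consistent (i.e. $\mathbf b$ lies in the column space of $\mathbf A$). Fix any row partition, any column partition, any step size $\alpha>0$, and any initial vector $\mathbf x^0\in\mathbb R^n$, and let $\mathbf x^k$ denote the $k$th iterate of the doubly stochastic block Gauss--Seidel (DSBGS) algorithm described in the context. Let $\mathbf x^0_\star:=(\mathbf I-\mathbf A^\dagger\mathbf A)\mathbf x^0+\mathbf A^\dagger\mathbf b$, which is the orthogonal projection of $\mathbf x^0$ onto the solution set $\{\mathbf x\in\mathbb R^n:\mathbf A\mathbf x=\mathbf b\}$. Then for every $k\ge 0$, $$\big\|\mathbb E[\mathbf x^k-\mathbf x^0_\star]\big\|_2\le\Big(\max_{1\le i\le r}\Big|1-\frac{\alpha\sigma_i^2(\mathbf A)}{\|\mathbf A\|_F^2}\Big|\Big)^k\|\mathbf x^0-\mathbf x^0_\star\|_2 .$$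
   Context: Notation: $\mathbf A^\dagger$ is the Moore--Penrose pseudoinverse, $\|\cdot\|_F$ the Frobenius norm, $\|\cdot\|_2$ the Euclidean norm (spectral norm for matrices). For $\mathcal I\subseteq[m]=\{1,\dots,m\}$ and $\mathcal J\subseteq[n]$, $\mathbf A_{\mathcal I,\mathcal J}$ is the submatrix of $\mathbf A$ with rows indexed by $\mathcal I$ and columns indexed by $\mathcal J$; $\mathbf A_{:,\mathcal J}$ is the column submatrix indexed by $\mathcal J$; $\mathbf I_{:,\mathcal J}$ denotes the columns of the identity matrix (of the appropriate order) indexed by $\mathcal J$. DSBGS algorithm: Let $\{\mathcal I_1,\dots,\mathcal I_s\}$ be a partition of $[m]$ into nonempty pairwise disjoint sets and $\{\mathcal J_1,\dots,\mathcal J_t\}$ a partition of $[n]$ into nonempty pairwise disjoint sets; let $\mathcal P=\{\mathcal I_1,\dots,\mathcal I_s\}\times\{\mathcal J_1,\dots,\mathcal J_t\}$. Given $\alpha>0$ and $\mathbf x^0\in\mathbb R^n$, for $k=1,2,\dots$: pick $(\mathcal I,\mathcal J)\in\mathcal P$ (independently of the previous choices) with probability $\|\mathbf A_{\mathcal I,\mathcal J}\|_F^2/\|\mathbf A\|_F^2$, and set $$\mathbf x^k=\mathbf x^{k-1}-\alpha\,\frac{\mathbf I_{:,\mathcal J}(\mathbf A_{\mathcal I,\mathcal J})^{T}(\mathbf I_{:,\mathcal I})^{T}}{\|\mathbf A_{\mathcal I,\mathcal J}\|_F^2}\,(\mathbf A\mathbf x^{k-1}-\mathbf b).$$ The expectation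 $\mathbb E$ is over the random choices of the blocks. *)

theory Defs
  imports "HOL-Probability.Probability"
begin

text \<open>Frobenius norm of an m x n real matrix (rows indexed by 'm, columns by 'n).\<close>
definition frob_norm :: "real^'n^'m \<Rightarrow> real" where
  "frob_norm A = sqrt (\<Sum>i\<in>UNIV. \<Sum>j\<in>UNIV. (A$i$j)^2)"

text \<open>Squared Frobenius norm of the submatrix A_{I,J}.\<close>
definition block_frob2 :: "real^'n^'m \<Rightarrow> 'm set \<Rightarrow> 'n set \<Rightarrow> real" where
  "block_frob2 A I J = (\<Sum>i\<in>I. \<Sum>j\<in>J. (A$i$j)^2)"

text \<open>Moore--Penrose pseudoinverse: the unique matrix satisfying the four Penrose equations.\<close>
definition pinv :: "real^'n^'m \<Rightarrow> real^'m^'n" where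
  "pinv A = (THE X. A ** X ** A = A \<and> X ** A ** X = X \<and>
                    transpose (A ** X) = A ** X \<and> transpose (X ** A) = X ** A)"

text \<open>Eigenvalue of a square real matrix.\<close>
definition is_eigenvalue :: "real^'n^'n \<Rightarrow> real \<Rightarrow> bool" where
  "is_eigenvalue M c \<longleftrightarrow> (\<exists>v. v \<noteq> 0 \<and> M *v v = c *\<^sub>R v)"

text \<open>Nonzero singular values: positive square roots of positive eigenvalues of A^T A.\<close>
definition nonzero_singular_values :: "real^'n^'m \<Rightarrow> real set" where
  "nonzero_singular_values A = {\<sigma>. \<sigma> > 0 \<and> is_eigenvalue (transpose A ** A) (\<sigma>^2)}"

text \<open>One DSBGS update with block (I,J):
  x - alpha * I_{:,J} (A_{I,J})^T (I_{:,I})^T (A x - b) / ||A_{I,J}||_F^2.\<close>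
definition dsbgs_step :: "real^'n^'m \<Rightarrow> real^'m \<Rightarrow> real \<Rightarrow> real^'n \<Rightarrow> 'm set \<Rightarrow> 'n set \<Rightarrow> real^'n" where
  "dsbgs_step A b \<alpha> x I J =
     (\<chi> j. x$j - (if j \<in> J then \<alpha> * (\<Sum>i\<in>I. A$i$j * ((A *v x - b)$i)) / block_frob2 A I J else 0))"

text \<open>Distribution of the block choice: (I,J) in RP x CP with probability ||A_{I,J}||_F^2/||A||_F^2.\<close>
definition block_pmf :: "real^'n^'m \<Rightarrow> 'm set set \<Rightarrow> 'n set set \<Rightarrow> ('m set \<times> 'n set) pmf" where
  "block_pmf A RP CP = embed_pmf (\<lambda>(I,J). if I \<in> RP \<and> J \<in> CP
        then block_frob2 A I J / (frob_norm A)^2 else 0)"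

text \<open>Distribution of the k-th DSBGS iterate x^k (block choices independent across iterations).\<close>
fun dsbgs_dist :: "real^'n^'m \<Rightarrow> real^'m \<Rightarrow> 'm set set \<Rightarrow> 'n set set \<Rightarrow> real \<Rightarrow> real^'n \<Rightarrow> nat \<Rightarrow> (real^'n) pmf" where
  "dsbgs_dist A b RP CP \<alpha> x0 0 = return_pmf x0"
| "dsbgs_dist A b RP CP \<alpha> x0 (Suc k) =
     bind_pmf (dsbgs_dist A b RP CP \<alpha> x0 k)
       (\<lambda>x. map_pmf (\<lambda>(I,J). dsbgs_step A b \<alpha> x I J) (block_pmf A RP CP))"

end

theory Submission
  imports Defs
begin

text \<open>
  Write \<open>\<gamma> = \<alpha> / \<parallel>A\<parallel>_F^2\<close> and \<open>T = I - \<gamma> A^T A\<close>. The expected error \<open>e_k = E[x^k] - x0s\<close>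
  obeys \<open>e_(k+1) = T e_k\<close>: block \<open>(I, J)\<close> is drawn with probability \<open>\<parallel>A_IJ\<parallel>_F^2 / \<parallel>A\<parallel>_F^2\<close>,
  which cancels the normalisation of the update, the blocks tile \<open>A\<close>, and \<open>A x0s = b\<close>.
  The initial error \<open>x^0 - x0s = pinv A (A x^0 - b)\<close> lies in the row space \<open>range A^T\<close>,
  which \<open>T\<close> leaves invariant. There the self-adjoint map \<open>T\<close> attains its norm at an
  eigenvector (maximise \<open>\<parallel>T v\<parallel>\<close> on the unit sphere of the row space), and an eigenvalue of
  \<open>T\<close> on the row space has the form \<open>1 - \<gamma> \<sigma>^2\<close> with \<open>\<sigma>\<close> a nonzero singular value.
\<close>

lemma inner_matrix_vector_mult_transpose:
  "((A::real^'n^'m) *v x) \<bullet> y = x \<bullet> (transpose A *v y)"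
  by (metis dot_lmul_matrix vector_transpose_matrix)

lemma subspace_range_matrix_vector_mult: "subspace (range ((*v) (A::real^'n^'m)))"
  by (rule linear_subspace_image[OF matrix_vector_mul_linear subspace_UNIV])

lemma orthogonal_projection_matrix_exists:
  fixes S :: "(real^'k) set"
  assumes "subspace S"
  obtains P :: "real^'k^'k" where "transpose P = P" "\<And>x. P *v x \<in> S" "\<And>x. x \<in> S \<Longrightarrow> P *v x = x"
    "\<And>x y. y \<in> S \<Longrightarrow> (x - P *v x) \<bullet> y = 0"
proof -
  obtain B where B: "B \<subseteq> S" "pairwise orthogonal B" "\<And>x. x \<in> B \<Longrightarrow> norm x = 1"
     "independent B" "span B = S"
    using orthonormal_basis_subspace[OF assms] by metis
  define P :: "real^'k^'k" where "P = (\<chi> i j. \<Sum>b\<in>B. b$i * b$j)"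
  have P_apply: "P *v x = (\<Sum>b\<in>B. (b \<bullet> x) *\<^sub>R b)" for x
    by (simp add: P_def vec_eq_iff matrix_vector_mult_def inner_vec_def sum_component
        sum_distrib_left sum_distrib_right sum.swap[of _ B] mult_ac)
  have "transpose P = P" by (simp add: P_def transpose_def vec_eq_iff mult.commute)
  moreover have in_S: "P *v x \<in> S" for x
    unfolding P_apply B(5)[symmetric] by (intro span_sum span_scale span_base)
  moreover have orth: "(x - P *v x) \<bullet> y = 0" if "y \<in> S" for x y
  proof -
    have "(\<Sum>b\<in>B. (b \<bullet> x / (b \<bullet> b)) *\<^sub>R b) = P *v x"
      using B(3) by (simp add: P_apply norm_eq_1)
    then show ?thesis
      using Gram_Schmidt_step[OF B(2), of y x] that B(5) by (simp add: orthogonal_def inner_commute)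
  qed
  moreover have "P *v x = x" if "x \<in> S" for x
  proof -
    have "x - P *v x \<in> S" using that in_S assms by (simp add: subspace_diff)
    then show ?thesis using orth[of _ x] by (metis eq_iff_diff_eq_0 inner_eq_zero_iff)
  qed
  ultimately show thesis using that by blast
qed

definition penrose_conditions :: "real^'n^'m \<Rightarrow> real^'m^'n \<Rightarrow> bool" where
  "penrose_conditions A X \<longleftrightarrow> A ** X ** A = A \<and> X ** A ** X = X \<and>
     transpose (A ** X) = A ** X \<and> transpose (X ** A) = X ** A"

context
  fixes A :: "real^'n^'m" and P :: "real^'n^'n"
  assumes P_sym: "transpose P = P"
    and P_range: "\<And>x. P *v x \<in> range ((*v) (transpose A))"
    and P_fix: "\<And>x. x \<in> range ((*v) (transpose A)) \<Longrightarrow> P *v x = x"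
    and P_orth: "\<And>x y. y \<in> range ((*v) (transpose A)) \<Longrightarrow> (x - P *v x) \<bullet> y = 0"
begin

lemma matrix_vector_mult_row_space_projection: "A *v (P *v x) = A *v x"
proof -
  let ?w = "x - P *v x"
  have "(A *v ?w) \<bullet> (A *v ?w) = 0"
    using P_orth[OF rangeI] by (simp add: inner_matrix_vector_mult_transpose)
  then show ?thesis by (simp add: matrix_vector_mult_diff_distrib)
qed

text \<open>\<open>A^T A + (I - P)\<close> acts as \<open>A^T A\<close> on the row space and as the identity on its
  orthogonal complement, the null space of \<open>A\<close>.\<close>

lemma inj_gram_plus_row_space_complement: "inj ((*v) (transpose A ** A + (mat 1 - P)))"
proof (rule linear_injective_0[OF matrix_vector_mul_linear, THEN iffD2], intro allI impI)
  fix x assume "(transpose A ** A + (mat 1 - P)) *v x = 0"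
  then have sum0: "transpose A *v (A *v x) + (x - P *v x) = 0"
    by (simp add: matrix_vector_mult_add_rdistrib matrix_vector_mult_diff_rdistrib
        matrix_vector_mul_assoc)
  have "(x - P *v x) \<bullet> (transpose A *v (A *v x)) = 0" using P_orth[OF rangeI] .
  with sum0 have "(x - P *v x) \<bullet> (x - P *v x) = 0"
    by (metis add_eq_0_iff inner_minus_right neg_equal_0_iff_equal)
  then have x_fix: "P *v x = x" by simp
  with sum0 have "(A *v x) \<bullet> (A *v x) = 0"
    by (simp add: inner_matrix_vector_mult_transpose)
  moreover obtain y where "x = transpose A *v y" using P_range[of x] x_fix by auto
  ultimately show "x = 0"
    by (metis inner_eq_zero_iff inner_matrix_vector_mult_transpose inner_zero_left)
qed

lemma penrose_conditions_exist_from_projection: "\<exists>X. penrose_conditions A X"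
proof -
  define M where "M = transpose A ** A + (mat 1 - P)"
  obtain B where BM: "B ** M = mat 1"
    using matrix_left_invertible_injective inj_gram_plus_row_space_complement M_def by blast
  then have MB: "M ** B = mat 1" using matrix_left_right_inverse by blast
  have "transpose M = M"
  proof -
    have "transpose (C + (mat 1 - P)) = transpose C + (mat 1 - transpose P)" for C :: "real^'n^'n"
      by (simp add: transpose_def vec_eq_iff mat_def)
    then show ?thesis by (simp add: M_def P_sym matrix_transpose_mul)
  qed
  then have B_sym: "transpose B = B"
    by (metis BM MB matrix_transpose_mul matrix_mul_assoc matrix_mul_lid matrix_mul_rid
        transpose_mat)
  have AP: "A ** P = A"
    by (simp add: matrix_eq matrix_vector_mult_row_space_projection flip: matrix_vector_mul_assoc)
  have MP: "M ** P = transpose A ** A"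
    using AP P_fix[OF P_range]
    by (simp add: M_def matrix_eq matrix_vector_mult_add_rdistrib matrix_vector_mult_diff_rdistrib
        flip: matrix_vector_mul_assoc matrix_mul_assoc)
  define X where "X = B ** transpose A"
  have XA: "X ** A = P"
    using MP by (metis BM X_def matrix_mul_assoc matrix_mul_lid)
  have AXA: "A ** X ** A = A" by (simp add: XA AP flip: matrix_mul_assoc)
  have AX_sym: "transpose (A ** X) = A ** X"
    by (simp add: X_def matrix_transpose_mul B_sym matrix_mul_assoc)
  have "transpose A ** (A ** X) = transpose A"
    using arg_cong[OF AXA, of transpose] AX_sym by (simp add: matrix_transpose_mul)
  then have "P ** X = X"
    by (metis BM MP X_def matrix_mul_assoc matrix_mul_lid)
  then have "X ** A ** X = X" by (simp add: XA)
  then show ?thesis unfolding penrose_conditions_def using AXA AX_sym XA P_sym by blast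
qed

end

lemma penrose_conditions_exist: "\<exists>X. penrose_conditions A X"
  using orthogonal_projection_matrix_exists[OF subspace_range_matrix_vector_mult]
    penrose_conditions_exist_from_projection by metis

lemma penrose_conditions_unique:
  assumes "penrose_conditions A X" "penrose_conditions A Y" shows "X = Y"
proof -
  have X: "A ** X ** A = A" "X ** A ** X = X" "transpose (A ** X) = A ** X"
      "transpose (X ** A) = X ** A"
    and Y: "A ** Y ** A = A" "Y ** A ** Y = Y" "transpose (A ** Y) = A ** Y"
      "transpose (Y ** A) = Y ** A"
    using assms unfolding penrose_conditions_def by auto
  have AtAY: "transpose A ** (A ** Y) = transpose A"
    using arg_cong[OF Y(1), of transpose] Y(3) by (simp add: matrix_transpose_mul)
  have XAAt: "X ** A ** transpose A = transpose A"
    using arg_cong[OF X(1), of transpose] X(4) by (simp add: matrix_transpose_mul matrix_mul_assoc)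
  have "X = X ** transpose X ** transpose A"
    using X(2) X(3) by (metis matrix_mul_assoc matrix_transpose_mul)
  also have "\<dots> = X ** A ** Y"
    using X(2) X(3) AtAY by (metis matrix_mul_assoc matrix_transpose_mul)
  also have "\<dots> = transpose A ** transpose Y ** Y"
    using XAAt by (metis Y(2) Y(4) matrix_mul_assoc matrix_transpose_mul)
  also have "\<dots> = Y"
    using Y(2) Y(4) by (metis matrix_mul_assoc matrix_transpose_mul)
  finally show ?thesis .
qed

lemma penrose_conditions_pinv: "penrose_conditions A (pinv A)"
proof -
  have "\<exists>!X. penrose_conditions A X"
    using penrose_conditions_exist penrose_conditions_unique by blast
  then show ?thesis unfolding pinv_def penrose_conditions_def[symmetric] by (rule theI')
qed

lemma pinv_projection_solves:
  assumes "b \<in> range ((*v) A)"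
  shows "A *v ((mat 1 - pinv A ** A) *v x + pinv A *v b) = b"
proof -
  obtain z where z: "b = A *v z" using assms by blast
  have "A ** pinv A ** A = A" using penrose_conditions_pinv unfolding penrose_conditions_def by blast
  then show ?thesis
    by (simp add: z matrix_vector_right_distrib matrix_vector_mult_diff_rdistrib
        matrix_vector_mult_diff_distrib matrix_vector_mul_assoc matrix_mul_assoc)
qed

lemma pinv_projection_residual_in_row_space:
  "x - ((mat 1 - pinv A ** A) *v x + pinv A *v b) \<in> range ((*v) (transpose A))"
proof -
  let ?X = "pinv A"
  have "?X = transpose (?X ** A) ** ?X"
    using penrose_conditions_pinv unfolding penrose_conditions_def by metis
  then have X_eq: "?X = transpose A ** (transpose ?X ** ?X)"
    by (simp add: matrix_transpose_mul matrix_mul_assoc)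
  have "x - ((mat 1 - ?X ** A) *v x + ?X *v b) = ?X *v (A *v x - b)"
    by (simp add: matrix_vector_mult_diff_rdistrib matrix_vector_mult_diff_distrib
        matrix_vector_mul_assoc)
  also have "\<dots> = transpose A *v ((transpose ?X ** ?X) *v (A *v x - b))"
    by (metis X_eq matrix_vector_mul_assoc)
  finally show ?thesis by blast
qed

lemma finite_eigenvalues_symmetric:
  fixes M :: "real^'n^'n"
  assumes sym: "transpose M = M"
  shows "finite {c. is_eigenvalue M c}"
proof -
  let ?E = "{c. is_eigenvalue M c}"
  define v where "v c = (SOME v. v \<noteq> 0 \<and> M *v v = c *\<^sub>R v)" for c
  have v: "v c \<noteq> 0" "M *v v c = c *\<^sub>R v c" if "c \<in> ?E" for c
    using that someI_ex[of "\<lambda>v. v \<noteq> 0 \<and> M *v v = c *\<^sub>R v"]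
    unfolding v_def is_eigenvalue_def by auto
  have orth: "v c \<bullet> v d = 0" if "c \<in> ?E" "d \<in> ?E" "c \<noteq> d" for c d
  proof -
    have "c * (v c \<bullet> v d) = d * (v c \<bullet> v d)"
      using inner_matrix_vector_mult_transpose[of M "v c" "v d"] sym v that by simp
    then show ?thesis using \<open>c \<noteq> d\<close> by simp
  qed
  have inj: "inj_on v ?E"
  proof (rule inj_onI, rule ccontr)
    fix c d assume "c \<in> ?E" "d \<in> ?E" "v c = v d" "c \<noteq> d"
    then show False using orth[of c d] v(1)[of c] by simp
  qed
  have "pairwise orthogonal (v ` ?E)"
    unfolding pairwise_def orthogonal_def using orth by blast
  moreover have "0 \<notin> v ` ?E" using v(1) by auto
  ultimately have "finite (v ` ?E)"
    using pairwise_orthogonal_independent independent_imp_finite by blast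
  then show ?thesis using finite_imageD inj by blast
qed

lemma finite_nonzero_singular_values: "finite (nonzero_singular_values A)"
proof -
  have "(\<lambda>s. s^2) ` nonzero_singular_values A \<subseteq> {c. is_eigenvalue (transpose A ** A) c}"
    unfolding nonzero_singular_values_def by auto
  then have "finite ((\<lambda>s. s^2) ` nonzero_singular_values A)"
    using finite_eigenvalues_symmetric[of "transpose A ** A"] finite_subset
    by (simp add: matrix_transpose_mul)
  moreover have "inj_on (\<lambda>s::real. s^2) (nonzero_singular_values A)"
    unfolding nonzero_singular_values_def by (auto intro!: inj_onI simp: power2_eq_iff_nonneg)
  ultimately show ?thesis using finite_imageD by blast
qed

lemma linear_coeff_eq_0_if_quadratic_nonpos:
  fixes a c :: real
  assumes "\<And>t. 2*t*a + t^2*c \<le> 0"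
  shows "a = 0"
proof -
  define d where "d = \<bar>c\<bar> + 1"
  have d: "d > 0" "2*d + c > 0" unfolding d_def by auto
  have "a^2 * (2*d + c) = (2*(a/d)*a + (a/d)^2*c) * d^2"
    using d by (simp add: field_simps power2_eq_square)
  also have "\<dots> \<le> 0" using assms[of "a/d"] by (simp add: mult_nonpos_nonneg)
  finally have "a^2 \<le> 0" using d by (simp add: mult_le_0_iff)
  then show ?thesis by simp
qed

lemma linear_norm_maximizer_on_subspace:
  fixes T :: "'a::euclidean_space \<Rightarrow> 'b::real_normed_vector"
  assumes "linear T" "subspace V" "v0 \<in> V" "v0 \<noteq> 0"
  obtains u where "u \<in> V" "norm u = 1" "\<And>v. v \<in> V \<Longrightarrow> norm (T v) \<le> norm (T u) * norm v"
proof -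
  define K where "K = V \<inter> sphere 0 1"
  have unit: "(1 / norm v) *\<^sub>R v \<in> K" if "v \<in> V" "v \<noteq> 0" for v
    using that assms(2) by (simp add: K_def subspace_scale)
  have "compact K"
    unfolding K_def using closed_subspace[OF assms(2)] by (intro closed_Int_compact) auto
  moreover have "K \<noteq> {}" using unit assms(3,4) by blast
  moreover have "continuous_on K (\<lambda>v. norm (T v))"
    using assms(1) by (intro continuous_on_norm linear_continuous_on)
      (simp add: linear_conv_bounded_linear)
  ultimately obtain u where u: "u \<in> K" and max: "\<And>v. v \<in> K \<Longrightarrow> norm (T v) \<le> norm (T u)"
    by (metis continuous_attains_sup)
  have "norm (T v) \<le> norm (T u) * norm v" if "v \<in> V" for v
  proof (cases "v = 0")
    case False
    then have "norm (T v) / norm v \<le> norm (T u)"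
      using max[OF unit[OF that]] linear_cmul[OF assms(1)] by simp
    then show ?thesis using False by (simp add: divide_le_eq mult.commute)
  qed (simp add: linear_0[OF assms(1)])
  moreover have "u \<in> V" "norm u = 1" using u by (auto simp: K_def)
  ultimately show thesis using that by blast
qed

lemma power2_norm_add_scaleR:
  fixes a c :: "'a::real_inner"
  shows "norm (a + t *\<^sub>R c)^2 = norm a^2 + 2*t*(a \<bullet> c) + t^2*(c \<bullet> c)"
  unfolding power2_norm_eq_inner
  by (simp add: inner_commute[of c a] power2_eq_square algebra_simps)

lemma self_adjoint_norm_maximizer_eigenvector_of_square:
  fixes T :: "'a::real_inner \<Rightarrow> 'a"
  assumes lin: "linear T" and adj: "\<And>x y. T x \<bullet> y = x \<bullet> T y"
    and V: "subspace V" "\<And>v. v \<in> V \<Longrightarrow> T v \<in> V"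
    and u: "u \<in> V" "norm u = 1"
    and max: "\<And>v. v \<in> V \<Longrightarrow> norm (T v) \<le> norm (T u) * norm v"
  shows "T (T u) = (norm (T u))^2 *\<^sub>R u"
proof -
  define m where "m = norm (T u)"
  define z where "z = T (T u) - m^2 *\<^sub>R u"
  have z: "z \<in> V" unfolding z_def using V u by (simp add: subspace_diff subspace_scale)
  have Tu_Tz: "T u \<bullet> T z = z \<bullet> z + m^2 * (u \<bullet> z)"
    using adj[of "T u" z] by (simp add: z_def inner_diff_left)
  \<comment> \<open>\<open>\<parallel>T v\<parallel>^2 - m^2 \<parallel>v\<parallel>^2\<close> is maximal (zero) at \<open>v = u\<close>, so its derivative in direction
    \<open>z\<close>, namely \<open>2 (z \<bullet> z)\<close>, vanishes.\<close>
  have "2*t*(z \<bullet> z) + t^2*(T z \<bullet> T z - m^2 * (z \<bullet> z)) \<le> 0" for t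
  proof -
    have "norm (T (u + t *\<^sub>R z))^2 \<le> (m * norm (u + t *\<^sub>R z))^2"
      using max[of "u + t *\<^sub>R z"] V u z unfolding m_def
      by (simp add: subspace_add subspace_scale power_mono)
    moreover have "T (u + t *\<^sub>R z) = T u + t *\<^sub>R T z"
      by (simp add: linear_add[OF lin] linear_cmul[OF lin])
    ultimately show ?thesis
      using u(2) by (simp add: power2_norm_add_scaleR m_def Tu_Tz power_mult_distrib algebra_simps)
  qed
  then have "z \<bullet> z = 0" by (rule linear_coeff_eq_0_if_quadratic_nonpos)
  then show ?thesis by (simp add: z_def m_def)
qed

lemma self_adjoint_eigenvector_attaining_norm:
  fixes T :: "'a::euclidean_space \<Rightarrow> 'a"
  assumes lin: "linear T" and adj: "\<And>x y. T x \<bullet> y = x \<bullet> T y"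
    and V: "subspace V" "\<And>v. v \<in> V \<Longrightarrow> T v \<in> V" and v0: "v0 \<in> V" "v0 \<noteq> 0"
  obtains w l where "w \<in> V" "w \<noteq> 0" "T w = l *\<^sub>R w"
    "\<And>v. v \<in> V \<Longrightarrow> norm (T v) \<le> \<bar>l\<bar> * norm v"
proof -
  obtain u where u: "u \<in> V" "norm u = 1"
    and max: "\<And>v. v \<in> V \<Longrightarrow> norm (T v) \<le> norm (T u) * norm v"
    using linear_norm_maximizer_on_subspace[OF lin V(1) v0] by blast
  define m where "m = norm (T u)"
  have TTu: "T (T u) = m^2 *\<^sub>R u"
    using self_adjoint_norm_maximizer_eigenvector_of_square[OF lin adj V u max] by (simp add: m_def)
  have bound: "norm (T v) \<le> \<bar>m\<bar> * norm v" if "v \<in> V" for v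
    using max[OF that] by (simp add: m_def)
  show thesis
  proof (cases "T u + m *\<^sub>R u = 0")
    case True
    then have "T u = (- m) *\<^sub>R u" by (simp add: eq_neg_iff_add_eq_0)
    moreover have "u \<noteq> 0" using u(2) by auto
    ultimately show thesis using that[of u "- m"] u(1) bound by simp
  next
    case False
    have "T (T u + m *\<^sub>R u) = m *\<^sub>R (T u + m *\<^sub>R u)"
      using TTu by (simp add: linear_add[OF lin] linear_cmul[OF lin] power2_eq_square
          scaleR_add_right)
    moreover have "T u + m *\<^sub>R u \<in> V" using V u by (simp add: subspace_add subspace_scale)
    ultimately show thesis using that[OF _ False] bound by blast
  qed
qed

lemma row_space_nonzero:
  fixes A :: "real^'n^'m"
  assumes "A \<noteq> 0"
  obtains y where "transpose A *v y \<noteq> 0"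
proof -
  obtain i j where "A$i$j \<noteq> 0" using assms by (metis vec_eq_iff zero_index)
  moreover have "(transpose A *v axis i 1) $ j = A$i$j"
    by (simp add: matrix_vector_mult_def transpose_def axis_def if_distrib cong: if_cong)
  ultimately show thesis using that by force
qed

lemma linear_gram_step: "linear (\<lambda>v. v - \<gamma> *\<^sub>R (transpose A *v ((A::real^'n^'m) *v v)))"
  by (intro linear_compose_sub linear_compose_scale_right linear_ident)
    (simp add: matrix_vector_mul_assoc)

lemma gram_step_row_space:
  fixes A :: "real^'n^'m"
  assumes "v \<in> range ((*v) (transpose A))"
  shows "v - \<gamma> *\<^sub>R (transpose A *v (A *v v)) \<in> range ((*v) (transpose A))"
  using assms subspace_range_matrix_vector_mult[of "transpose A"]
  by (auto simp: subspace_diff subspace_scale)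

lemma gram_step_self_adjoint:
  fixes A :: "real^'n^'m"
  shows "(x - \<gamma> *\<^sub>R (transpose A *v (A *v x))) \<bullet> y = x \<bullet> (y - \<gamma> *\<^sub>R (transpose A *v (A *v y)))"
proof -
  have "(transpose A *v (A *v x)) \<bullet> y = (A *v x) \<bullet> (A *v y)"
    using inner_matrix_vector_mult_transpose[of "transpose A"] by simp
  moreover have "x \<bullet> (transpose A *v (A *v y)) = (A *v x) \<bullet> (A *v y)"
    by (simp add: inner_matrix_vector_mult_transpose)
  ultimately show ?thesis by (simp add: inner_diff_left inner_diff_right)
qed

lemma gram_eigenvalue_on_row_space_pos:
  fixes A :: "real^'n^'m"
  assumes "w \<in> range ((*v) (transpose A))" "w \<noteq> 0" "(transpose A ** A) *v w = \<mu> *\<^sub>R w"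
  shows "\<mu> > 0"
proof (rule ccontr)
  assume "\<not> \<mu> > 0"
  moreover have "\<mu> * (w \<bullet> w) = (A *v w) \<bullet> (A *v w)"
    using assms(3) by (simp add: inner_matrix_vector_mult_transpose matrix_vector_mul_assoc)
  ultimately have "A *v w = 0"
    by (metis inner_eq_zero_iff inner_ge_zero mult_nonpos_nonneg not_less order_antisym)
  moreover obtain z where "w = transpose A *v z" using assms(1) by blast
  ultimately have "w \<bullet> w = 0"
    by (metis inner_matrix_vector_mult_transpose inner_zero_left transpose_transpose)
  then show False using assms(2) by simp
qed

lemma gram_step_bound_on_row_space:
  fixes A :: "real^'n^'m"
  assumes "\<gamma> \<noteq> 0" "A \<noteq> 0"
  obtains \<sigma> where "\<sigma> \<in> nonzero_singular_values A"
    "\<And>v. v \<in> range ((*v) (transpose A)) \<Longrightarrow>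
       norm (v - \<gamma> *\<^sub>R (transpose A *v (A *v v))) \<le> \<bar>1 - \<gamma> * \<sigma>^2\<bar> * norm v"
proof -
  let ?T = "\<lambda>v. v - \<gamma> *\<^sub>R (transpose A *v (A *v v))" and ?V = "range ((*v) (transpose A))"
  obtain y where "transpose A *v y \<noteq> 0" using row_space_nonzero[OF assms(2)] .
  then obtain w l where w: "w \<in> ?V" "w \<noteq> 0" "?T w = l *\<^sub>R w"
    and bound: "\<And>v. v \<in> ?V \<Longrightarrow> norm (?T v) \<le> \<bar>l\<bar> * norm v"
    using self_adjoint_eigenvector_attaining_norm[of ?T ?V "transpose A *v y",
        OF linear_gram_step gram_step_self_adjoint subspace_range_matrix_vector_mult
        gram_step_row_space rangeI] by blast
  define \<mu> where "\<mu> = (1 - l) / \<gamma>"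
  have "(1 - l) *\<^sub>R w = \<gamma> *\<^sub>R ((transpose A ** A) *v w)"
    using w(3) by (simp add: algebra_simps flip: matrix_vector_mul_assoc)
  then have "(transpose A ** A) *v w = (1 / \<gamma>) *\<^sub>R ((1 - l) *\<^sub>R w)"
    using assms(1) by simp
  then have eig: "(transpose A ** A) *v w = \<mu> *\<^sub>R w"
    by (simp add: \<mu>_def)
  then have "\<mu> > 0" using gram_eigenvalue_on_row_space_pos w(1,2) by blast
  then have "sqrt \<mu> \<in> nonzero_singular_values A"
    using eig w(2) by (auto simp: nonzero_singular_values_def is_eigenvalue_def)
  moreover have "\<bar>1 - \<gamma> * (sqrt \<mu>)^2\<bar> = \<bar>l\<bar>"
    using \<open>\<mu> > 0\<close> assms(1) by (simp add: \<mu>_def)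
  ultimately show thesis using that bound by metis
qed

lemma sum_partition_on:
  fixes P :: "'a::finite set set"
  assumes "partition_on UNIV P"
  shows "(\<Sum>I\<in>P. \<Sum>i\<in>I. g i) = (\<Sum>i\<in>UNIV. g i)"
proof -
  have "\<forall>A\<in>P. \<forall>B\<in>P. A \<noteq> B \<longrightarrow> A \<inter> B = {}"
    using assms unfolding partition_on_def by (auto dest: disjointD)
  then have "(\<Sum>i\<in>\<Union>P. g i) = (\<Sum>I\<in>P. \<Sum>i\<in>I. g i)"
    using sum.Union_disjoint[of P g] by simp
  moreover have "\<Union>P = UNIV" using assms unfolding partition_on_def by simp
  ultimately show ?thesis by simp
qed

lemma sum_partition_on_member:
  fixes P :: "'a::finite set set"
  assumes "partition_on UNIV P"
  shows "(\<Sum>I\<in>P. if j \<in> I then c else 0) = c"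
  using sum_partition_on[OF assms, of "\<lambda>i. if i = j then c else 0"] by simp

lemma sum_block_frob2:
  assumes "partition_on UNIV RP" "partition_on UNIV CP"
  shows "(\<Sum>I\<in>RP. \<Sum>J\<in>CP. block_frob2 A I J) = (frob_norm A)^2"
proof -
  have "(\<Sum>J\<in>CP. block_frob2 A I J) = (\<Sum>i\<in>I. \<Sum>j\<in>UNIV. (A$i$j)^2)" for I
    unfolding block_frob2_def by (subst sum.swap) (simp add: sum_partition_on[OF assms(2)])
  then show ?thesis
    by (simp add: sum_partition_on[OF assms(1)] frob_norm_def sum_nonneg)
qed

lemma frob_norm_pos:
  assumes "A \<noteq> 0"
  shows "frob_norm A > 0"
proof -
  obtain i j where "A$i$j \<noteq> 0" using assms by (metis vec_eq_iff zero_index)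
  then have "(\<Sum>i\<in>UNIV. \<Sum>j\<in>UNIV. (A$i$j)^2) > 0"
    by (intro sum_pos2[of _ i] sum_pos2[of _ j]) (auto intro: sum_nonneg)
  then show ?thesis by (simp add: frob_norm_def)
qed

lemma block_frob2_nonneg: "block_frob2 A I J \<ge> 0"
  unfolding block_frob2_def by (intro sum_nonneg) auto

lemma pmf_block_pmf:
  assumes "A \<noteq> 0" "partition_on UNIV RP" "partition_on UNIV CP"
  shows "pmf (block_pmf A RP CP) (I, J) =
    (if I \<in> RP \<and> J \<in> CP then block_frob2 A I J / (frob_norm A)^2 else 0)"
proof -
  define f where "f = (\<lambda>(I, J). if I \<in> RP \<and> J \<in> CP then block_frob2 A I J / (frob_norm A)^2 else 0)"
  have f_nonneg: "0 \<le> f p" for p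
    unfolding f_def by (auto simp: block_frob2_nonneg case_prod_unfold)
  have "(\<Sum>p\<in>UNIV. f p) = (\<Sum>(I, J)\<in>RP \<times> CP. block_frob2 A I J / (frob_norm A)^2)"
    by (rule sum.mono_neutral_cong_right) (auto simp: f_def split: if_splits)
  also have "\<dots> = (\<Sum>I\<in>RP. \<Sum>J\<in>CP. block_frob2 A I J) / (frob_norm A)^2"
    by (simp add: sum.cartesian_product[symmetric] sum_divide_distrib)
  also have "\<dots> = 1"
    using frob_norm_pos[OF assms(1)] by (simp add: sum_block_frob2[OF assms(2,3)])
  finally have "(\<integral>\<^sup>+p. ennreal (f p) \<partial>count_space UNIV) = 1"
    by (simp add: nn_integral_count_space_finite sum_ennreal f_nonneg)
  then show ?thesis
    using pmf_embed_pmf[of f] f_nonneg unfolding block_pmf_def f_def by simp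
qed

lemma expectation_block_pmf:
  fixes g :: "'m::finite set \<times> 'n::finite set \<Rightarrow> real^'k"
  assumes "A \<noteq> 0" "partition_on UNIV RP" "partition_on UNIV CP"
  shows "measure_pmf.expectation (block_pmf A RP CP) g =
    (\<Sum>I\<in>RP. \<Sum>J\<in>CP. (block_frob2 A I J / (frob_norm A)^2) *\<^sub>R g (I, J))"
proof -
  have "measure_pmf.expectation (block_pmf A RP CP) g =
      (\<Sum>p\<in>RP \<times> CP. pmf (block_pmf A RP CP) p *\<^sub>R g p)"
    by (rule integral_measure_pmf) (auto simp: set_pmf_eq pmf_block_pmf[OF assms] split: if_splits)
  then show ?thesis
    by (simp only: sum.cartesian_product) (intro sum.cong refl, clarsimp simp: pmf_block_pmf[OF assms])
qed

lemma block_frob2_eq_0_imp_entry_eq_0: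
  assumes "block_frob2 A I J = 0" "i \<in> I" "j \<in> J"
  shows "A$i$j = 0"
  using assms unfolding block_frob2_def by (simp add: sum_nonneg_eq_0_iff sum_nonneg)

lemma expectation_dsbgs_step:
  assumes "A \<noteq> 0" "partition_on UNIV RP" "partition_on UNIV CP"
  shows "measure_pmf.expectation (block_pmf A RP CP) (\<lambda>(I, J). dsbgs_step A b \<alpha> x I J)
    = x - (\<alpha> / (frob_norm A)^2) *\<^sub>R (transpose A *v (A *v x - b))"
proof -
  define F where "F = (frob_norm A)^2"
  define r where "r = A *v x - b"
  \<comment> \<open>A vanishing block makes the update divide by zero (which is \<open>0\<close> in HOL), but then
    its weight and its contribution are zero anyway.\<close>
  have weighted_step: "((block_frob2 A I J / F) *\<^sub>R dsbgs_step A b \<alpha> x I J) $ j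
      = block_frob2 A I J / F * x$j - (if j \<in> J then \<alpha> / F * (\<Sum>i\<in>I. A$i$j * r$i) else 0)"
    for I J j
    by (auto simp: dsbgs_step_def right_diff_distrib block_frob2_eq_0_imp_entry_eq_0 simp flip: r_def)
  have "(\<Sum>I\<in>RP. \<Sum>J\<in>CP. (block_frob2 A I J / F) *\<^sub>R dsbgs_step A b \<alpha> x I J) $ j
      = x$j - (\<alpha> / F) * (transpose A *v r) $ j" for j
  proof -
    have "(\<Sum>I\<in>RP. \<Sum>J\<in>CP. (block_frob2 A I J / F) *\<^sub>R dsbgs_step A b \<alpha> x I J) $ j
        = (\<Sum>I\<in>RP. \<Sum>J\<in>CP. block_frob2 A I J / F * x$j)
          - (\<Sum>I\<in>RP. \<Sum>J\<in>CP. if j \<in> J then \<alpha> / F * (\<Sum>i\<in>I. A$i$j * r$i) else 0)"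
      by (simp only: sum_component weighted_step sum_subtractf)
    also have "\<dots> = x$j - (\<alpha> / F) * (\<Sum>I\<in>RP. \<Sum>i\<in>I. A$i$j * r$i)"
      using frob_norm_pos[OF assms(1)]
      by (simp add: F_def sum_partition_on_member[OF assms(3)] sum_block_frob2[OF assms(2,3)]
          sum_distrib_left flip: sum_distrib_right sum_divide_distrib)
    also have "\<dots> = x$j - (\<alpha> / F) * (transpose A *v r) $ j"
      by (simp add: sum_partition_on[OF assms(2)] matrix_vector_mult_def transpose_def)
    finally show ?thesis .
  qed
  then show ?thesis
    by (simp add: expectation_block_pmf[OF assms] vec_eq_iff F_def r_def)
qed

lemma finite_set_pmf_dsbgs_dist: "finite (set_pmf (dsbgs_dist A b RP CP \<alpha> x0 k))"
  by (induction k) auto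

lemma expectation_bind_pmf_finite:
  fixes f :: "'b \<Rightarrow> 'c::{banach, second_countable_topology}"
  assumes "finite (set_pmf M)" "\<And>x. x \<in> set_pmf M \<Longrightarrow> finite (set_pmf (N x))"
  shows "measure_pmf.expectation (bind_pmf M N) f
    = measure_pmf.expectation M (\<lambda>x. measure_pmf.expectation (N x) f)"
  using pmf_expectation_bind[of "set_pmf M" N M f] assms
    integral_measure_pmf[OF assms(1), of M "\<lambda>x. measure_pmf.expectation (N x) f"]
  by simp

lemma expectation_dsbgs_dist_error:
  assumes "A \<noteq> 0" "partition_on UNIV RP" "partition_on UNIV CP" "A *v xs = b"
  shows "measure_pmf.expectation (dsbgs_dist A b RP CP \<alpha> x0 k) (\<lambda>x. x - xs)
    = ((\<lambda>v. v - (\<alpha> / (frob_norm A)^2) *\<^sub>R (transpose A *v (A *v v))) ^^ k) (x0 - xs)"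
proof (induction k)
  case (Suc k)
  define T where "T v = v - (\<alpha> / (frob_norm A)^2) *\<^sub>R (transpose A *v (A *v v))" for v
  have step: "measure_pmf.expectation (map_pmf (\<lambda>(I, J). dsbgs_step A b \<alpha> x I J) (block_pmf A RP CP))
      (\<lambda>y. y - xs) = T (x - xs)" for x
  proof -
    have "measure_pmf.expectation (map_pmf (\<lambda>(I, J). dsbgs_step A b \<alpha> x I J) (block_pmf A RP CP))
        (\<lambda>y. y - xs)
        = measure_pmf.expectation (block_pmf A RP CP) (\<lambda>(I, J). dsbgs_step A b \<alpha> x I J) - xs"
      by (simp add: integrable_measure_pmf_finite)
    then show ?thesis
      using assms(4) by (simp add: expectation_dsbgs_step[OF assms(1-3)] T_def
          matrix_vector_mult_diff_distrib algebra_simps)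
  qed
  have "measure_pmf.expectation (dsbgs_dist A b RP CP \<alpha> x0 (Suc k)) (\<lambda>x. x - xs)
      = measure_pmf.expectation (dsbgs_dist A b RP CP \<alpha> x0 k) (\<lambda>x. T (x - xs))"
    unfolding dsbgs_dist.simps step[symmetric]
    by (rule expectation_bind_pmf_finite) (simp_all add: finite_set_pmf_dsbgs_dist)
  also have "\<dots> = T (measure_pmf.expectation (dsbgs_dist A b RP CP \<alpha> x0 k) (\<lambda>x. x - xs))"
    using linear_gram_step unfolding T_def linear_conv_bounded_linear
    by (intro integral_bounded_linear integrable_measure_pmf_finite finite_set_pmf_dsbgs_dist)
  finally show ?case using Suc.IH by (simp add: T_def)
qed simp

lemma norm_funpow_le:
  fixes T :: "'a::real_normed_vector \<Rightarrow> 'a"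
  assumes "\<And>v. v \<in> V \<Longrightarrow> T v \<in> V" "\<And>v. v \<in> V \<Longrightarrow> norm (T v) \<le> c * norm v"
    and "0 \<le> c" "v \<in> V"
  shows "norm ((T ^^ k) v) \<le> c ^ k * norm v"
proof (induction k)
  case (Suc k)
  have "(T ^^ k) v \<in> V" using assms(1,4) by (induction k) auto
  then have "norm ((T ^^ Suc k) v) \<le> c * norm ((T ^^ k) v)" using assms(2) by simp
  also have "\<dots> \<le> c * (c ^ k * norm v)" using Suc.IH assms(3) by (rule mult_left_mono)
  finally show ?case by (simp add: mult.assoc)
qed simp

theorem theorem1:
  fixes A :: "real^'n^'m" and b :: "real^'m" and x0 :: "real^'n"
    and RP :: "'m set set" and CP :: "'n set set" and \<alpha> :: real and k :: nat
  assumes "A \<noteq> 0"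
    and "b \<in> range (\<lambda>x. A *v x)"
    and "partition_on UNIV RP" and "partition_on UNIV CP"
    and "\<alpha> > 0"
  defines "x0s \<equiv> (mat 1 - pinv A ** A) *v x0 + pinv A *v b"
  shows "norm (measure_pmf.expectation (dsbgs_dist A b RP CP \<alpha> x0 k) (\<lambda>x. x - x0s))
           \<le> (Max ((\<lambda>\<sigma>. \<bar>1 - \<alpha> * \<sigma>^2 / (frob_norm A)^2\<bar>) ` nonzero_singular_values A)) ^ k
              * norm (x0 - x0s)"
proof -
  let ?\<gamma> = "\<alpha> / (frob_norm A)^2"
  let ?T = "\<lambda>v. v - ?\<gamma> *\<^sub>R (transpose A *v (A *v v))"
  let ?\<rho> = "Max ((\<lambda>\<sigma>. \<bar>1 - \<alpha> * \<sigma>^2 / (frob_norm A)^2\<bar>) ` nonzero_singular_values A)"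
  have "?\<gamma> \<noteq> 0" using assms(5) frob_norm_pos[OF assms(1)] by simp
  then obtain \<sigma> where \<sigma>: "\<sigma> \<in> nonzero_singular_values A"
    and bound: "\<And>v. v \<in> range ((*v) (transpose A)) \<Longrightarrow>
      norm (?T v) \<le> \<bar>1 - ?\<gamma> * \<sigma>^2\<bar> * norm v"
    using gram_step_bound_on_row_space assms(1) by metis
  have "\<bar>1 - ?\<gamma> * \<sigma>^2\<bar> \<le> ?\<rho>"
    using \<sigma> finite_nonzero_singular_values by (intro Max_ge) auto
  have "measure_pmf.expectation (dsbgs_dist A b RP CP \<alpha> x0 k) (\<lambda>x. x - x0s)
      = (?T ^^ k) (x0 - x0s)"
    using expectation_dsbgs_dist_error[OF assms(1,3,4) pinv_projection_solves[OF assms(2)]]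
    unfolding x0s_def .
  also have "norm \<dots> \<le> \<bar>1 - ?\<gamma> * \<sigma>^2\<bar> ^ k * norm (x0 - x0s)"
    unfolding x0s_def
    by (rule norm_funpow_le[OF gram_step_row_space bound abs_ge_zero
          pinv_projection_residual_in_row_space])
  also have "\<dots> \<le> ?\<rho> ^ k * norm (x0 - x0s)"
    using \<open>\<bar>1 - ?\<gamma> * \<sigma>^2\<bar> \<le> ?\<rho>\<close> by (intro mult_right_mono power_mono) auto
  finally show ?thesis .
qed

end
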